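(* No graph with tree-width \(2\) is the underlying graph of a complete-convex \(2\)-edge-coloured graph.
   Context: A \(2\)-edge-coloured graph is a pair \((G,c_G)\), \(G\) a graph without parallel edges and \(c_G:E_G\to\{R,B\}\); \(G\) is its underlying graph. A path \(u,v,w\) with \(uv,vw\in E_G\), \(u\ne v\ne w\), is an alternating \(2\)-path with centre \(v\) if \(c_G(uv)\ne c_G(vw)\). A vertex set \(S\) is convex if no vertex outside \(S\) is the centre of an alternating \(2\)-path with both ends in \(S\); \(conv(S)\) is the smallest convex set containing \(S\), \(conv(uv)=conv(\{u,v\})\). \((G,c_G)\) is complete convex if \(conv(uv)=V_G\) for every edge \(uv\). *)

theory Defs
  imports "Graph_Theory.Digraph_Component" "HOL.Hull"
begin

text \<open>
  An undirected graph is a symmetric digraph whose arcs are pairs of vertices, so parallel edges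
  cannot occur; \<^locale>\<open>pair_pseudo_graph\<close> adds finiteness and allows loops,
  \<^locale>\<open>pair_graph\<close> excludes them. An edge between \<open>u\<close> and \<open>v\<close> is
  coloured through the unordered pair \<open>{u, v}\<close>; the values of a colouring on sets that are
  not edges are irrelevant.
\<close>

datatype colour = Red | Blue

definition alternating_2path ::
    "'a pair_pre_digraph \<Rightarrow> ('a set \<Rightarrow> colour) \<Rightarrow> 'a \<Rightarrow> 'a \<Rightarrow> 'a \<Rightarrow> bool" where
  "alternating_2path G c u v w \<longleftrightarrow>
     (u, v) \<in> parcs G \<and> (v, w) \<in> parcs G \<and> u \<noteq> v \<and> v \<noteq> w \<and> c {u, v} \<noteq> c {v, w}"

definition convex_set :: "'a pair_pre_digraph \<Rightarrow> ('a set \<Rightarrow> colour) \<Rightarrow> 'a set \<Rightarrow> bool" where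
  "convex_set G c S \<longleftrightarrow> S \<subseteq> pverts G \<and>
     \<not> (\<exists>v \<in> pverts G - S. \<exists>u \<in> S. \<exists>w \<in> S. alternating_2path G c u v w)"

definition conv :: "'a pair_pre_digraph \<Rightarrow> ('a set \<Rightarrow> colour) \<Rightarrow> 'a set \<Rightarrow> 'a set" where
  "conv G c S = convex_set G c hull S"

definition complete_convex :: "'a pair_pre_digraph \<Rightarrow> ('a set \<Rightarrow> colour) \<Rightarrow> bool" where
  "complete_convex G c \<longleftrightarrow> (\<forall>u v. (u, v) \<in> parcs G \<longrightarrow> conv G c {u, v} = pverts G)"

text \<open>
  The library constant \<^const>\<open>tree\<close> forbids directed cycles, and in a symmetric digraph
  every edge gives the directed cycle \<open>u, v, u\<close>. Cycles of length at least 3 are exactly the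
  cycles of the undirected graph.
\<close>

definition undirected_tree :: "'a pair_pre_digraph \<Rightarrow> bool" where
  "undirected_tree T \<longleftrightarrow> pair_graph T \<and> connected (with_proj T) \<and>
     \<not> (\<exists>p. pre_digraph.cycle (with_proj T) p \<and> 3 \<le> length p)"

definition tree_decomposition ::
    "'a pair_pre_digraph \<Rightarrow> 'b pair_pre_digraph \<Rightarrow> ('b \<Rightarrow> 'a set) \<Rightarrow> bool" where
  "tree_decomposition G T bag \<longleftrightarrow> undirected_tree T \<and>
     (\<Union>t \<in> pverts T. bag t) = pverts G \<and>
     (\<forall>u v. (u, v) \<in> parcs G \<longrightarrow> (\<exists>t \<in> pverts T. u \<in> bag t \<and> v \<in> bag t)) \<and>
     (\<forall>v \<in> pverts G. connected (with_proj T \<restriction> {t \<in> pverts T. v \<in> bag t}))"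

definition decomposition_width :: "'b pair_pre_digraph \<Rightarrow> ('b \<Rightarrow> 'a set) \<Rightarrow> nat" where
  "decomposition_width T bag = Max ((\<lambda>t. card (bag t)) ` pverts T) - 1"

text \<open>
  Decomposition trees are finite, so taking their nodes in \<^typ>\<open>nat\<close> loses no generality.
  The truncated subtraction above only matters for the graph without vertices, which gets
  tree-width 0 instead of -1.
\<close>

definition treewidth :: "'a pair_pre_digraph \<Rightarrow> nat" where
  "treewidth G = (LEAST k. \<exists>(T :: nat pair_pre_digraph) bag.
     tree_decomposition G T bag \<and> decomposition_width T bag = k)"

end

theory Submission
  imports Defs
begin

text \<open>
  If \<open>{u, v}\<close> is not convex, some \<open>w\<close> forms a triangle with the edge \<open>uv\<close> in which
  \<open>uw\<close> and \<open>vw\<close> have different colours. Suppose that \<open>v\<close> has at most two neighbours. Applying this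
  to the edges at \<open>v\<close> shows that they have the same colour, so \<open>v\<close> is never the centre of an
  alternating 2-path. The complement of \<open>v\<close> is then convex and contains an edge, a contradiction.
  Graphs of tree-width at most 2 do have such a vertex: root the decomposition tree and choose
  the vertex whose highest node is deepest; all its neighbours lie in the bag of that node.
\<close>

section \<open>Vertices with neighbourhood in a bag\<close>

text \<open>Keeping track of the arcs used lets the deletion of an edge be expressed by shrinking
  \<open>B\<close>.\<close>

lemma (in pair_wf_digraph) rtrancl_awalk:
  assumes "(x, y) \<in> B\<^sup>*" "x \<in> pverts G" "B \<subseteq> parcs G"
  obtains p where "awalk x p y" "set p \<subseteq> B"
proof -
  have "\<exists>p. awalk x p y \<and> set p \<subseteq> B"
    using assms(1)
  proof (induction rule: rtrancl_induct)
    case base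
    have "awalk x [] x" using assms(2) by (simp add: awalk_Nil_iff)
    then show ?case by (intro exI[of _ "[]"]) simp
  next
    case (step y z)
    obtain p where p: "awalk x p y" "set p \<subseteq> B"
      using step.IH by blast
    have "awalk y [(y, z)] z" using step.hyps(2) assms(3) by (auto simp: awalk_simps in_arcsD2)
    with p(1) have "awalk x (p @ [(y, z)]) z" by (rule awalk_appendI)
    then show ?case using p(2) step.hyps(2) by (intro exI[of _ "p @ [(y, z)]"]) simp
  qed
  then show ?thesis using that by blast
qed

text \<open>A path from \<open>a\<close> to \<open>b\<close> avoiding the edge would close up with
  \<open>(b, a)\<close> to a cycle. The path has at least two arcs, since \<open>a\<close> and
  \<open>b\<close> differ and the single arc \<open>(a, b)\<close> is excluded; so the cycle has
  length at least 3.\<close>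

lemma undirected_tree_bridge:
  assumes T: "undirected_tree T" and e: "(a, b) \<in> parcs T"
  shows "(a, b) \<notin> (parcs T - {(a, b), (b, a)})\<^sup>*"
proof
  assume r: "(a, b) \<in> (parcs T - {(a, b), (b, a)})\<^sup>*"
  interpret pair_graph T using T by (simp add: undirected_tree_def)
  have "a \<in> pverts T" using e by (rule in_arcsD1)
  with r obtain p where p: "awalk a p b" "set p \<subseteq> parcs T - {(a, b), (b, a)}"
    by (rule rtrancl_awalk) auto
  define q where "q = awalk_to_apath p"
  have q: "apath a q b" "set q \<subseteq> parcs T - {(a, b), (b, a)}"
    using apath_awalk_to_apath[OF p(1)] awalk_to_apath_subset[OF p(1)] p(2)
    unfolding q_def by blast+
  have ab: "a \<noteq> b" using e by (rule no_loops')
  have "2 \<le> length q"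
  proof (rule ccontr)
    assume "\<not> 2 \<le> length q"
    then consider "q = []" | x where "q = [x]"
      by (cases q; cases "tl q") auto
    then show False using q ab by cases (auto simp: apath_simps)
  qed
  moreover have "cycle ((b, a) # q)"
    unfolding cycle_def using q(1) e
    by (auto simp: apath_def awalk_Cons_iff arcs_symmetric intro!: exI[of _ b])
  ultimately show False using T
    by (force simp: undirected_tree_def)
qed

text \<open>Leaving \<open>R\<close> free makes this usable for the whole tree and also for the arcs
  inside an induced subtree.\<close>

lemma connected_rtrancl:
  assumes "connected H" "arcs_ends H \<subseteq> R" "sym R" "x \<in> verts H" "y \<in> verts H"
  shows "(x, y) \<in> R\<^sup>*"
proof -
  have "x \<rightarrow>\<^sup>*\<^bsub>with_proj (mk_symmetric H)\<^esub> y"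
    using assms by (auto simp: connected_def strongly_connected_def mk_symmetric_def)
  then have "(x, y) \<in> (parcs (mk_symmetric H))\<^sup>*"
    using reachable_rtranclI by fastforce
  moreover have "parcs (mk_symmetric H) \<subseteq> R"
    using assms(2,3) by (auto simp: mk_symmetric_def arcs_ends_conv dest: symD)
  ultimately show ?thesis using rtrancl_mono by blast
qed

text \<open>Distance from the root \<open>r\<close>, unspecified at nodes that \<open>r\<close> does
  not reach; in the connected tree below there are none.\<close>

definition depth :: "'b rel \<Rightarrow> 'b \<Rightarrow> 'b \<Rightarrow> nat" where
  "depth R r x = (LEAST n. (r, x) \<in> R ^^ n)"

text \<open>The node \<open>y\<close> is the last but one on a shortest walk from \<open>r\<close>
  to \<open>x\<close>.\<close>

lemma depth_parent:
  assumes "(r, x) \<in> R\<^sup>*" "x \<noteq> r"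
  obtains y where "(y, x) \<in> R" "(r, y) \<in> R\<^sup>*" "depth R r y < depth R r x"
proof -
  have x: "(r, x) \<in> R ^^ depth R r x"
    unfolding depth_def using assms(1) by (auto simp: rtrancl_power intro: LeastI)
  with assms(2) obtain n where n: "depth R r x = Suc n"
    by (cases "depth R r x") auto
  with x obtain y where y: "(r, y) \<in> R ^^ n" "(y, x) \<in> R" by auto
  have "depth R r y \<le> n" unfolding depth_def using y(1) by (rule Least_le)
  then show ?thesis using y n by (intro that[of y]) (auto simp: rtrancl_power)
qed

text \<open>Climbing from \<open>x\<close> to parents strictly decreases the depth, so all later
  nodes are less deep than \<open>t\<close>. The climb thus never visits \<open>t\<close> and cannot
  use an edge at \<open>t\<close>.\<close>

lemma root_rtrancl_avoiding:
  assumes "sym R" "(r, x) \<in> R\<^sup>*" "x \<noteq> t" "depth R r x \<le> depth R r t"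
  shows "(x, r) \<in> (R - {(t, p), (p, t)})\<^sup>*"
  using assms(2-)
proof (induction "depth R r x" arbitrary: x rule: less_induct)
  case less
  show ?case
  proof (cases "x = r")
    case False
    then obtain y where y: "(y, x) \<in> R" "(r, y) \<in> R\<^sup>*" "depth R r y < depth R r x"
      using depth_parent less.prems(1) by metis
    then have "(y, r) \<in> (R - {(t, p), (p, t)})\<^sup>*"
      using less.prems by (intro less.hyps) auto
    moreover have "(x, y) \<in> R - {(t, p), (p, t)}"
      using y less.prems \<open>sym R\<close> by (auto dest: symD)
    ultimately show ?thesis by (rule converse_rtrancl_into_rtrancl[rotated])
  qed simp
qed

text \<open>Let \<open>t\<close> be the top node of the chosen \<open>v\<close> and \<open>p\<close>
  its parent. If a neighbour \<open>w\<close> were missing from \<open>bag t\<close>, then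
  \<open>t\<close> and \<open>p\<close> would be joined without the edge between them: from
  \<open>t\<close> to a node \<open>s\<close> shared by \<open>v\<close> and \<open>w\<close>, on to
  \<open>top w\<close>, up to the root and down to \<open>p\<close>.\<close>

lemma tree_decomposition_closed_neighbourhood_in_bag:
  assumes G: "pair_pseudo_graph G" and ne: "pverts G \<noteq> {}"
    and td: "tree_decomposition G T bag"
  obtains v t where "v \<in> pverts G" "t \<in> pverts T" "insert v {w. (v, w) \<in> parcs G} \<subseteq> bag t"
proof -
  interpret G: pair_pseudo_graph G by fact
  have tree: "undirected_tree T" using td by (simp add: tree_decomposition_def)
  interpret T: pair_graph T using tree by (simp add: undirected_tree_def)
  define R where "R = parcs T"
  have symR: "sym R" using T.pair_sym_arcs by (simp add: R_def symmetric_def)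
  have "pverts T \<noteq> {}"
    using td ne by (auto simp: tree_decomposition_def)
  then obtain r where r: "r \<in> pverts T" by blast
  have reach: "(r, x) \<in> R\<^sup>*" if "x \<in> pverts T" for x
    using connected_rtrancl[of "with_proj T" R r x] tree symR r that
    by (simp add: undirected_tree_def R_def)
  define N where "N v = {t \<in> pverts T. v \<in> bag t}" for v
  have N_sub: "N v \<subseteq> pverts T" for v by (auto simp: N_def)
  have N_ne: "N v \<noteq> {}" if "v \<in> pverts G" for v
    using td that by (auto simp: tree_decomposition_def N_def)
  have N_conn: "(x, y) \<in> (R \<inter> N v \<times> N v)\<^sup>*" if "v \<in> pverts G" "x \<in> N v" "y \<in> N v" for v x y
  proof (rule connected_rtrancl)
    show "connected (with_proj T \<restriction> N v)"
      using td that(1) by (simp add: tree_decomposition_def N_def)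
    show "arcs_ends (with_proj T \<restriction> N v) \<subseteq> R \<inter> N v \<times> N v"
      by (auto simp: arcs_ends_conv R_def)
    show "sym (R \<inter> N v \<times> N v)" using symR by (auto simp: sym_def)
  qed (use that in auto)
  have "\<exists>t. t \<in> N v \<and> (\<forall>s \<in> N v. depth R r t \<le> depth R r s)" if "v \<in> pverts G" for v
    using ex_has_least_nat[of "\<lambda>t. t \<in> N v" _ "depth R r"] N_ne[OF that] by blast
  then obtain top where top: "\<And>v. v \<in> pverts G \<Longrightarrow> top v \<in> N v"
    "\<And>v s. \<lbrakk>v \<in> pverts G; s \<in> N v\<rbrakk> \<Longrightarrow> depth R r (top v) \<le> depth R r s" by metis
  have "Max ((\<lambda>v. depth R r (top v)) ` pverts G) \<in> (\<lambda>v. depth R r (top v)) ` pverts G"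
    using ne G.pair_finite_verts by (intro Max_in) auto
  then obtain v where v: "v \<in> pverts G" and
    "depth R r (top v) = Max ((\<lambda>v. depth R r (top v)) ` pverts G)" by auto
  then have deepest: "depth R r (top w) \<le> depth R r (top v)" if "w \<in> pverts G" for w
    using that G.pair_finite_verts by auto
  define t where "t = top v"
  have t: "t \<in> N v" "t \<in> pverts T" using top(1)[OF v] N_sub by (auto simp: t_def)
  have "w \<in> bag t" if vw: "(v, w) \<in> parcs G" for w
  proof (rule ccontr)
    assume w_out: "w \<notin> bag t"
    have w: "w \<in> pverts G" using vw by (rule G.in_arcsD2)
    obtain s where "s \<in> pverts T" "v \<in> bag s" "w \<in> bag s"
      using td vw unfolding tree_decomposition_def by blast
    then have s: "s \<in> N v" "s \<in> N w" by (auto simp: N_def)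
    have tN: "t \<notin> N w" using w_out by (simp add: N_def)
    then have tw: "top w \<noteq> t" using top(1)[OF w] by auto
    \<comment> \<open>At the root, maximality of the depth of \<open>t\<close> would force
      \<open>top w\<close> to have depth 0 as well, hence to equal \<open>t\<close>.\<close>
    have "t \<noteq> r"
    proof
      assume "t = r"
      then have "depth R r (top w) = 0"
        using deepest[OF w] by (simp add: t_def[symmetric] depth_def Least_eq_0)
      moreover have "(r, top w) \<in> R\<^sup>*" using reach top(1)[OF w] N_sub by blast
      ultimately show False using depth_parent[of r "top w" R] tw \<open>t = r\<close> by auto
    qed
    then obtain p where p: "(p, t) \<in> R" "(r, p) \<in> R\<^sup>*" "depth R r p < depth R r t"
      using depth_parent reach t(2) by metis
    \<comment> \<open>Neither subtree contains the edge between \<open>t\<close> and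
      \<open>p\<close>: \<open>N v\<close> omits \<open>p\<close>, which is less deep than the top
      of \<open>N v\<close>, and \<open>N w\<close> omits \<open>t\<close>.\<close>
    let ?B = "R - {(t, p), (p, t)}"
    have "p \<notin> N v" using top(2)[OF v, of p] p(3) by (auto simp: t_def)
    then have "R \<inter> N v \<times> N v \<subseteq> ?B" by auto
    then have "(t, s) \<in> ?B\<^sup>*" using N_conn[OF v t(1) s(1)] rtrancl_mono by blast
    also have "R \<inter> N w \<times> N w \<subseteq> ?B" using tN by auto
    then have "(s, top w) \<in> ?B\<^sup>*" using N_conn[OF w s(2) top(1)[OF w]] rtrancl_mono by blast
    also have "(top w, r) \<in> ?B\<^sup>*"
      using symR tw deepest[OF w] reach top(1)[OF w] N_sub
      by (intro root_rtrancl_avoiding) (auto simp: t_def)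
    also have "(r, p) \<in> ?B\<^sup>*"
    proof -
      have "(p, r) \<in> ?B\<^sup>*" using symR p by (intro root_rtrancl_avoiding) auto
      moreover have "sym (?B\<^sup>*)" using symR by (intro sym_rtrancl) (auto simp: sym_def)
      ultimately show ?thesis by (blast dest: symD)
    qed
    finally show False
      using undirected_tree_bridge[OF tree, of t p] p(1) symR by (auto simp: R_def dest: symD)
  qed
  then show ?thesis using that v t by (auto simp: N_def)
qed

section \<open>Upper bounds for the tree-width\<close>

lemma treewidth_le:
  fixes T :: "nat pair_pre_digraph"
  assumes "tree_decomposition G T bag"
  shows "treewidth G \<le> decomposition_width T bag"
  unfolding treewidth_def using assms by (intro Least_le) blast

lemma connected_singleton:
  "verts G = {x} \<Longrightarrow> connected G"
  by (auto simp: connected_def strongly_connected_def mk_symmetric_def reachable_def)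

text \<open>This trivial decomposition shows that the minimum defining \<open>treewidth\<close> is
  attained, and bounds it by the number of vertices.\<close>

lemma tree_decomposition_single_bag:
  assumes "pair_pseudo_graph G"
  shows "tree_decomposition G \<lparr>pverts = {0 :: nat}, parcs = {}\<rparr> (\<lambda>_. pverts G)"
proof -
  interpret G: pair_pseudo_graph G by fact
  let ?T = "\<lparr>pverts = {0 :: nat}, parcs = {}\<rparr>"
  interpret T: pair_graph ?T by unfold_locales (auto simp: symmetric_def sym_def)
  have "\<not> T.cycle p" for p
    by (cases p) (auto simp: T.cycle_def T.awalk_Cons_iff)
  then show ?thesis
    by (auto simp: tree_decomposition_def undirected_tree_def T.pair_graph connected_singleton
        dest: G.in_arcsD1 G.in_arcsD2)
qed

lemma treewidth_le_card:
  assumes "pair_pseudo_graph G"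
  shows "treewidth G \<le> card (pverts G) - 1"
  using treewidth_le[OF tree_decomposition_single_bag[OF assms]]
  by (simp add: decomposition_width_def)

lemma treewidth_attained:
  assumes "pair_pseudo_graph G"
  obtains T :: "nat pair_pre_digraph" and bag where
    "tree_decomposition G T bag" "decomposition_width T bag = treewidth G"
proof -
  have "\<exists>k (T :: nat pair_pre_digraph) bag.
      tree_decomposition G T bag \<and> decomposition_width T bag = k"
    using tree_decomposition_single_bag[OF assms] by blast
  from LeastI_ex[OF this] show ?thesis using that unfolding treewidth_def by blast
qed

text \<open>Any tree on \<open>n + 1\<close> nodes would serve to carry singleton bags; in a star,
  connectivity and the absence of long cycles are easy to check. The centre is 0.\<close>

definition star :: "nat \<Rightarrow> nat pair_pre_digraph" where
  "star n = \<lparr>pverts = {..n}, parcs = {0} \<times> {1..n} \<union> {1..n} \<times> {0}\<rparr>"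

lemma undirected_tree_star: "undirected_tree (star n)"
proof -
  interpret T: pair_graph "star n"
    by unfold_locales (auto simp: star_def symmetric_def sym_def)
  have verts: "pverts (star n) = {..n}"
    and arcs: "parcs (star n) = {0} \<times> {1..n} \<union> {1..n} \<times> {0}"
    by (simp_all add: star_def)
  have "x \<rightarrow>\<^sup>*\<^bsub>star n\<^esub> y" if "x \<le> n" "y \<le> n" for x y
  proof -
    have "x \<rightarrow>\<^sup>*\<^bsub>star n\<^esub> 0"
    proof (cases "x = 0")
      case True
      then show ?thesis by (simp add: verts)
    next
      case False
      then show ?thesis using that by (intro T.reachable_adjI) (auto simp: star_def)
    qed
    moreover have "0 \<rightarrow>\<^sup>*\<^bsub>star n\<^esub> y"
    proof (cases "y = 0")
      case True
      then show ?thesis by (simp add: verts)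
    next
      case False
      then show ?thesis using that by (intro T.reachable_adjI) (auto simp: star_def)
    qed
    ultimately show ?thesis by (rule T.reachable_trans)
  qed
  moreover have "mk_symmetric (with_proj (star n)) = star n"
    by (auto simp: mk_symmetric_def star_def)
  ultimately have "connected (with_proj (star n))"
    by (auto simp: connected_def strongly_connected_def star_def)
  moreover have False if cyc: "T.cycle p" and len: "3 \<le> length p" for p
  proof -
    obtain e1 e2 e3 q where "p = e1 # e2 # e3 # q"
      using len by (metis Suc_le_length_iff numeral_3_eq_3)
    \<comment> \<open>Walks alternate between centre and leaves. Hence three arcs cannot close up,
      and with four or more the centre occurs twice after the start, against distinctness.\<close>
    with cyc show False
      by (cases q; cases "tl q") (auto simp: T.cycle_def T.awalk_Cons_iff T.awalk_Nil_iff arcs)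
  qed
  ultimately show ?thesis using T.pair_graph by (auto simp: undirected_tree_def)
qed

text \<open>Singleton bags, one per vertex, have width 0. An edgeless graph is vacuously complete
  convex, so tree-width 2 must rule it out.\<close>

lemma treewidth_no_arcs:
  assumes "pair_pseudo_graph G" "parcs G = {}"
  shows "treewidth G = 0"
proof (cases "pverts G = {}")
  case True
  \<comment> \<open>The bound is the truncated difference \<open>0 - 1 = 0\<close>.\<close>
  then show ?thesis using treewidth_le_card[OF assms(1)] by simp
next
  case False
  interpret G: pair_pseudo_graph G by fact
  define n where "n = card (pverts G) - 1"
  have "card (pverts G) = Suc n"
    using False G.pair_finite_verts by (simp add: n_def card_gt_0_iff)
  then obtain f where f: "bij_betw f {..n} (pverts G)"
    using G.pair_finite_verts
    by (metis card_atMost finite_atMost finite_same_card_bij)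
  have "connected (with_proj (star n) \<restriction> {t \<in> {..n}. v \<in> {f t}})" if v: "v \<in> pverts G" for v
  proof -
    have "v \<in> f ` {..n}" using f v by (simp add: bij_betw_def)
    then obtain i where "i \<le> n" "f i = v" by blast
    then have "{t \<in> {..n}. v \<in> {f t}} = {i}"
      using f by (auto simp: bij_betw_def inj_on_def)
    then show ?thesis by (intro connected_singleton[of _ i]) simp
  qed
  moreover have "pverts (star n) = {..n}" by (simp add: star_def)
  ultimately have "tree_decomposition G (star n) (\<lambda>t. {f t})"
    using f assms(2) undirected_tree_star by (auto simp: tree_decomposition_def bij_betw_def)
  moreover have "decomposition_width (star n) (\<lambda>t. {f t}) = 0"
    by (simp add: decomposition_width_def star_def)
  ultimately show ?thesis using treewidth_le by fastforce
qed

section \<open>Complete convex colourings\<close>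

text \<open>The hull of an edge lies in every convex set containing that edge. To refute complete
  convexity it thus suffices to find a proper convex subset containing an edge.\<close>

lemma complete_convex_convex_set:
  assumes "complete_convex G c" "(u, v) \<in> parcs G" "convex_set G c S" "u \<in> S" "v \<in> S"
  shows "S = pverts G"
proof (rule subset_antisym)
  show "pverts G \<subseteq> S"
    using assms hull_minimal[of "{u, v}" S "convex_set G c"]
    by (auto simp: complete_convex_def conv_def)
  show "S \<subseteq> pverts G" using assms(3) by (simp add: convex_set_def)
qed

lemma complete_convex_triangle:
  assumes G: "pair_pseudo_graph G" and cc: "complete_convex G c"
    and card: "3 \<le> card (pverts G)" and uv: "(u, v) \<in> parcs G"
  obtains w where "(u, w) \<in> parcs G" "(v, w) \<in> parcs G" "w \<noteq> u" "w \<noteq> v" "c {u, w} \<noteq> c {v, w}"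
proof -
  interpret G: pair_pseudo_graph G by fact
  have "card {u, v} \<le> 2" by (cases "u = v") auto
  then have "\<not> convex_set G c {u, v}"
    using complete_convex_convex_set[OF cc uv, of "{u, v}"] card by auto
  then obtain w x y where w: "w \<notin> {u, v}" "x \<in> {u, v}" "y \<in> {u, v}" "alternating_2path G c x w y"
    using uv by (auto simp: convex_set_def dest: G.in_arcsD1 G.in_arcsD2)
  \<comment> \<open>With equal ends, both steps of the 2-path would be the same edge, with one
    colour.\<close>
  then have "x \<noteq> y" by (auto simp: alternating_2path_def insert_commute)
  with w show ?thesis
    by (intro that[of w]) (auto simp: alternating_2path_def insert_commute dest: G.arcs_symmetric)
qed

text \<open>The triangle on a loop degenerates: its two differently coloured sides would
  coincide.\<close>

lemma complete_convex_loopfree: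
  assumes "pair_pseudo_graph G" "complete_convex G c" "3 \<le> card (pverts G)"
  shows "(v, v) \<notin> parcs G"
  using complete_convex_triangle[OF assms] by metis

lemma complete_convex_degree:
  assumes G: "pair_pseudo_graph G" and cc: "complete_convex G c"
    and card: "3 \<le> card (pverts G)" and arcs: "parcs G \<noteq> {}" and v: "v \<in> pverts G"
  shows "3 \<le> card {w. (v, w) \<in> parcs G}"
proof (rule ccontr)
  interpret G: pair_pseudo_graph G by fact
  let ?N = "{w. (v, w) \<in> parcs G}"
  assume "\<not> 3 \<le> card ?N"
  then have card_N: "card ?N \<le> 2" by simp
  have fin: "finite ?N"
    using G.pair_finite_verts by (rule finite_subset[rotated]) (auto dest: G.in_arcsD2)
  \<comment> \<open>This form covers both an isolated \<open>v\<close> and a \<open>v\<close> with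
    neighbours: the edge \<open>ab\<close> will survive the removal of \<open>v\<close>.\<close>
  have "\<exists>a b. (a, b) \<in> parcs G \<and> a \<noteq> v \<and> b \<noteq> v \<and> (\<forall>x y. \<not> alternating_2path G c x v y)"
  proof (cases "?N = {}")
    case True
    then show ?thesis using arcs
      by (auto simp: alternating_2path_def dest: G.arcs_symmetric)
  next
    case False
    then obtain u where u: "(v, u) \<in> parcs G" by blast
    obtain w where w: "(v, w) \<in> parcs G" "(u, w) \<in> parcs G" "w \<noteq> v" "w \<noteq> u" "c {v, w} \<noteq> c {u, w}"
      using complete_convex_triangle[OF G cc card u] by metis
    have "{u, w} = ?N"
      using u w card_N fin by (intro card_seteq) auto
    then have N: "x = u \<or> x = w" if "(v, x) \<in> parcs G" for x using that by blast
    obtain x where x: "(v, x) \<in> parcs G" "(w, x) \<in> parcs G" "x \<noteq> w" "c {v, x} \<noteq> c {w, x}"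
      using complete_convex_triangle[OF G cc card w(1)] by metis
    then have "x = u" using N by blast
    \<comment> \<open>Both colours differ from that of \<open>uw\<close>, and there are only two
      colours.\<close>
    then have "c {v, u} = c {v, w}"
      using x(4) w(5) by (cases "c {v, u}"; cases "c {v, w}"; cases "c {u, w}")
        (auto simp: insert_commute)
    then have "c {v, x} = c {v, y}" if "(v, x) \<in> parcs G" "(v, y) \<in> parcs G" for x y
      using N[OF that(1)] N[OF that(2)] by auto
    then have "\<not> alternating_2path G c x v y" for x y
      unfolding alternating_2path_def by (metis G.arcs_symmetric insert_commute)
    moreover have "u \<noteq> v" using u complete_convex_loopfree[OF G cc card] by auto
    ultimately show ?thesis using w by blast
  qed
  then obtain a b where ab: "(a, b) \<in> parcs G" "a \<noteq> v" "b \<noteq> v"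
    and "\<And>x y. \<not> alternating_2path G c x v y" by blast
  then have "convex_set G c (pverts G - {v})" by (auto simp: convex_set_def)
  then have "pverts G - {v} = pverts G"
    using ab by (intro complete_convex_convex_set[OF cc ab(1)]) (auto dest: G.in_arcsD1 G.in_arcsD2)
  then show False using v by blast
qed

theorem theorem17:
  fixes G :: "'a pair_pre_digraph"
  assumes "pair_pseudo_graph G"
    and "treewidth G = 2"
  shows "\<not> (\<exists>c. complete_convex G c)"
proof
  assume "\<exists>c. complete_convex G c"
  then obtain c where cc: "complete_convex G c" ..
  interpret G: pair_pseudo_graph G by fact
  have card: "3 \<le> card (pverts G)" using treewidth_le_card[OF assms(1)] assms(2) by simp
  have arcs: "parcs G \<noteq> {}" using treewidth_no_arcs[OF assms(1)] assms(2) by auto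
  obtain T :: "nat pair_pre_digraph" and bag where
    td: "tree_decomposition G T bag" and width: "decomposition_width T bag = 2"
    using treewidth_attained[OF assms(1)] assms(2) by metis
  have "pverts G \<noteq> {}" using card by auto
  then obtain v t where v: "v \<in> pverts G" and t: "t \<in> pverts T"
    and bag: "insert v {w. (v, w) \<in> parcs G} \<subseteq> bag t"
    using tree_decomposition_closed_neighbourhood_in_bag[OF assms(1) _ td] by metis
  have "finite (pverts T)"
    using td by (auto simp: tree_decomposition_def undirected_tree_def pair_graph_def
        pair_digraph_def dest: pair_fin_digraph.pair_finite_verts)
  then have "card (bag t) \<le> Max ((\<lambda>t. card (bag t)) ` pverts T)" using t by (intro Max_ge) auto
  \<comment> \<open>Width is the maximal bag size minus one, so width 2 allows three vertices per
    bag.\<close>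
  then have card_bag: "card (bag t) \<le> 3" using width by (simp add: decomposition_width_def)
  have "bag t \<subseteq> pverts G" using td t by (auto simp: tree_decomposition_def)
  then have fin: "finite (bag t)" using G.pair_finite_verts by (rule finite_subset)
  have "{w. (v, w) \<in> parcs G} \<subseteq> bag t" using bag by simp
  then have "finite {w. (v, w) \<in> parcs G}" using fin by (rule finite_subset)
  \<comment> \<open>Without a loop, \<open>v\<close> occupies one of the at most three places in the
    bag, which leaves at most two neighbours.\<close>
  moreover have "v \<notin> {w. (v, w) \<in> parcs G}"
    using complete_convex_loopfree[OF assms(1) cc card] by simp
  ultimately have "Suc (card {w. (v, w) \<in> parcs G}) \<le> 3"
    using card_mono[OF fin bag] card_bag by simp
  then show False using complete_convex_degree[OF assms(1) cc card arcs v] by simp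
qed

end
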